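(* Assume Conditions 1, 2 and 3 (stated in the context) hold and that $k'(-1)>0$. Then for every $c\in\mathbb{N}$, every $z\in\{1,2,\ldots,c\}$ and every $(i,j)\in\mathbb{X}^2$, $$\lim_{n\to+\infty}\mathbb{P}_i\left(Z_n=z\,\middle|\,1\le Z_n\le c,\;X_n=j\right)=\frac1c,$$ i.e. the limit distribution is uniform on $\{1,\ldots,c\}$.
   Context: Notation: $\mathbb{N}=\{1,2,\ldots\}$, $\mathbb{N}_0=\mathbb{N}\cup\{0\}$. Environment: $X=(X_n)_{n\ge0}$ is a time-homogeneous Markov chain with finite state space $\mathbb{X}$ and transition matrix $\mathbf{P}=(\mathbf{P}(i,j))_{i,j\in\mathbb{X}}$. $\mathbb{P}_i$, $\mathbb{E}_i$ denote probability and expectation when $X_0=i$, and $\mathbf{P}g(i)=\mathbb{E}_i[g(X_1)]$ for $g$ on $\mathbb{X}$. Linear fractional offspring: for each $i\in\mathbb{X}$ let $a_i\in[0,1)$, $p_i\in(0,1)$. The offspring law in state $i$ is the probability on $\mathbb{N}_0$ giving mass $a_i$ to $0$ and mass $(1-a_i)(1-p_i)p_i^{k-1}$ to each $k\in\mathbb{N}$; its generating function is $f_i(s)=1-\frac{(1-a_i)(1-s)}{1-p_is}$, $s\in[0,1]$, with mean $m_i=f_i'(1)=\frac{1-a_i}{1-p_i}$. Branching process: $Z_0=1$ and $Z_n=\sum_{l=1}^{Z_{n-1}}\xi^{n,l}_{X_n}$ for $n\in\mathbb{N}$, where the random variables $\xi^{n,l}_i$ ($i\in\mathbb{X}$, $n,l\ge1$)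 are independent, independent of the chain $X$, and $\xi_i^{n,l}$ has the offspring law of state $i$. Markov walk: $\rho(i)=\ln f_i'(1)=\ln m_i$, $S_0=0$, $S_n=\sum_{k=1}^n\rho(X_k)$. For $\lambda\in\mathbb{R}$, $k(\lambda)=\lim_{n\to+\infty}\big(\mathbb{E}_i[e^{\lambda S_n}]\big)^{1/n}$; under Conditions 1 and 2 this limit exists, is positive, does not depend on $i$, and $k$ is differentiable. Condition 1 (irreducible and aperiodic environment): there is $k_0\in\mathbb{N}$ such that for every non-negative, not identically zero function $g$ on $\mathbb{X}$ and every $i\in\mathbb{X}$, $\mathbf{P}^{k_0}g(i)>0$. Condition 2 (non-lattice environment): for any $(\theta,b)\in\mathbb{R}^2$ there exists a path $x_0,\ldots,x_n$ in $\mathbb{X}$ with $\mathbf{P}(x_0,x_1)\cdots\mathbf{P}(x_{n-1},x_n)\mathbf{P}(x_n,x_0)>0$ and $\rho(x_0)+\cdots+\rho(x_n)-(n+1)\theta\notin b\mathbb{Z}$. Condition 3 (supercritical branching): $0<a_i<p_i<1$ for every $i\in\mathbb{X}$. *)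

theory Defs
  imports "HOL-Probability.Probability"
begin

definition lf_mass :: "real \<Rightarrow> real \<Rightarrow> nat \<Rightarrow> real" where
  "lf_mass a p k = (if k = 0 then a else (1 - a) * (1 - p) * p ^ (k - 1))"

definition lf_gen :: "real \<Rightarrow> real \<Rightarrow> real \<Rightarrow> real" where
  "lf_gen a p s = 1 - (1 - a) * (1 - s) / (1 - p * s)"

lemma lf_mass_sums_lf_gen:
  fixes a p s :: real
  assumes "0 < p" "p < 1" "0 \<le> s" "s \<le> 1"
  shows "(\<lambda>k. lf_mass a p k * s ^ k) sums lf_gen a p s"
proof -
  have "p * s \<le> p"
    using assms by (simp add: mult_left_le)
  hence "p * s < 1"
    using assms(2) by linarith
  moreover have "0 \<le> p * s"
    using assms by simp
  ultimately have ps: "0 \<le> p * s" "p * s < 1"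
    by blast+
  have "(\<lambda>k. (1 - a) * (1 - p) * s * (p * s) ^ k) sums ((1 - a) * (1 - p) * s * (1 / (1 - p * s)))"
    using ps by (intro sums_mult geometric_sums) auto
  hence "(\<lambda>k. lf_mass a p (Suc k) * s ^ Suc k) sums ((1 - a) * (1 - p) * s * (1 / (1 - p * s)))"
    by (simp add: lf_mass_def power_mult_distrib algebra_simps)
  hence "(\<lambda>k. lf_mass a p k * s ^ k) sums ((1 - a) * (1 - p) * s * (1 / (1 - p * s)) + a)"
    by (subst (asm) sums_Suc_iff) (simp add: lf_mass_def)
  also have "(1 - a) * (1 - p) * s * (1 / (1 - p * s)) + a = lf_gen a p s"
    using ps by (simp add: lf_gen_def field_simps)
  finally show ?thesis .
qed

lemma deriv_lf_gen_1:
  fixes a p :: real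
  assumes "p < 1"
  shows "deriv (lf_gen a p) 1 = (1 - a) / (1 - p)"
proof (rule DERIV_imp_deriv)
  have "1 - p \<noteq> 0"
    using assms by simp
  thus "(lf_gen a p has_field_derivative (1 - a) / (1 - p)) (at 1)"
    unfolding lf_gen_def [abs_def]
    by (auto intro!: derivative_eq_intros simp: minus_divide_left)
qed

definition log_mean :: "('x \<Rightarrow> real) \<Rightarrow> ('x \<Rightarrow> real) \<Rightarrow> 'x \<Rightarrow> real" where
  "log_mean a p i = ln (deriv (lf_gen (a i) (p i)) 1)"

definition stochastic_matrix :: "real^'x^'x \<Rightarrow> bool" where
  "stochastic_matrix P \<longleftrightarrow> (\<forall>i j. 0 \<le> P $ i $ j) \<and> (\<forall>i. (\<Sum>j\<in>UNIV. P $ i $ j) = 1)"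

definition markov_chain_from ::
    "real^'x^'x \<Rightarrow> 'x::finite \<Rightarrow> 'w measure \<Rightarrow> (nat \<Rightarrow> 'w \<Rightarrow> 'x) \<Rightarrow> bool" where
  "markov_chain_from P i M X \<longleftrightarrow>
     (\<forall>n. X n \<in> measurable M (count_space UNIV)) \<and>
     (AE \<omega> in M. X 0 \<omega> = i) \<and>
     (\<forall>n x y. \<P>(\<omega> in M. \<forall>k\<le>n. X k \<omega> = x k) > 0 \<longrightarrow>
        \<P>(\<omega> in M. X (Suc n) \<omega> = y \<bar> \<forall>k\<le>n. X k \<omega> = x k) = P $ x n $ y)"

abbreviation offspring_index :: "('x \<times> nat \<times> nat) set" where
  "offspring_index \<equiv> UNIV \<times> {1..} \<times> {1..}"

text \<open>\<open>\<xi> i n l\<close> is the variable with state \<open>i\<close>, generation \<open>n \<ge> 1\<close> and individual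
  \<open>l \<ge> 1\<close>; nothing is required for \<open>n = 0\<close> or \<open>l = 0\<close>. The library's \<open>indep_var\<close> needs
  equal value types, so independence of the family from the chain is stated for the two generated
  sigma-algebras.\<close>
definition lf_offspring_family ::
    "('x \<Rightarrow> real) \<Rightarrow> ('x \<Rightarrow> real) \<Rightarrow> 'w measure \<Rightarrow> (nat \<Rightarrow> 'w \<Rightarrow> 'x) \<Rightarrow>
     ('x \<Rightarrow> nat \<Rightarrow> nat \<Rightarrow> 'w \<Rightarrow> nat) \<Rightarrow> bool" where
  "lf_offspring_family a p M X \<xi> \<longleftrightarrow>
     prob_space.indep_vars M (\<lambda>_. count_space UNIV) (\<lambda>(i, n, l). \<xi> i n l) offspring_index \<and>
     prob_space.indep_set M
       (sets (vimage_algebra (space M) (\<lambda>\<omega> n. X n \<omega>)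
          (PiM UNIV (\<lambda>_. count_space UNIV))))
       (sets (vimage_algebra (space M) (\<lambda>\<omega>. \<lambda>(i, n, l)\<in>offspring_index. \<xi> i n l \<omega>)
          (PiM offspring_index (\<lambda>_. count_space UNIV)))) \<and>
     (\<forall>(i, n, l)\<in>offspring_index. \<forall>k. \<P>(\<omega> in M. \<xi> i n l \<omega> = k) = lf_mass (a i) (p i) k)"

text \<open>\<open>M i\<close> is the law $\mathbb{P}_i$ on the common sample space.\<close>
definition lf_branching_in_markov_env ::
    "real^'x^'x \<Rightarrow> ('x::finite \<Rightarrow> real) \<Rightarrow> ('x \<Rightarrow> real) \<Rightarrow> ('x \<Rightarrow> 'w measure) \<Rightarrow>
     (nat \<Rightarrow> 'w \<Rightarrow> 'x) \<Rightarrow> ('x \<Rightarrow> nat \<Rightarrow> nat \<Rightarrow> 'w \<Rightarrow> nat) \<Rightarrow> bool" where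
  "lf_branching_in_markov_env P a p M X \<xi> \<longleftrightarrow>
     stochastic_matrix P \<and>
     (\<forall>i. 0 \<le> a i \<and> a i < 1 \<and> 0 < p i \<and> p i < 1) \<and>
     (\<forall>i. prob_space (M i) \<and> markov_chain_from P i (M i) X \<and> lf_offspring_family a p (M i) X \<xi>)"

primrec branching ::
    "(nat \<Rightarrow> 'w \<Rightarrow> 'x) \<Rightarrow> ('x \<Rightarrow> nat \<Rightarrow> nat \<Rightarrow> 'w \<Rightarrow> nat) \<Rightarrow> nat \<Rightarrow> 'w \<Rightarrow> nat" where
  "branching X \<xi> 0 \<omega> = 1"
| "branching X \<xi> (Suc n) \<omega> = (\<Sum>l = 1..branching X \<xi> n \<omega>. \<xi> (X (Suc n) \<omega>) (Suc n) l \<omega>)"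

definition markov_walk ::
    "('x \<Rightarrow> real) \<Rightarrow> ('x \<Rightarrow> real) \<Rightarrow> (nat \<Rightarrow> 'w \<Rightarrow> 'x) \<Rightarrow> nat \<Rightarrow> 'w \<Rightarrow> real" where
  "markov_walk a p X n \<omega> = (\<Sum>k = 1..n. log_mean a p (X k \<omega>))"

text \<open>The common value over all starting states of the limits; meaningful when these limits exist
  and agree, as is the case under \<open>primitive_env\<close>.\<close>
definition walk_growth ::
    "('x \<Rightarrow> real) \<Rightarrow> ('x \<Rightarrow> real) \<Rightarrow> ('x \<Rightarrow> 'w measure) \<Rightarrow> (nat \<Rightarrow> 'w \<Rightarrow> 'x) \<Rightarrow> real \<Rightarrow> real" where
  "walk_growth a p M X t =
     (THE r. \<forall>i. (\<lambda>n. (\<integral>\<omega>. exp (t * markov_walk a p X n \<omega>) \<partial>M i) powr (1 / real n))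
        \<longlonglongrightarrow> r)"

definition primitive_env :: "real^'x^'x::finite \<Rightarrow> bool" where
  "primitive_env P \<longleftrightarrow>
     (\<exists>k0\<ge>1. \<forall>g. (\<forall>i. 0 \<le> g $ i) \<and> g \<noteq> 0 \<longrightarrow> (\<forall>i. ((((*v) P) ^^ k0) g) $ i > 0))"

definition non_lattice_env ::
    "real^'x^'x \<Rightarrow> ('x::finite \<Rightarrow> real) \<Rightarrow> ('x \<Rightarrow> real) \<Rightarrow> bool" where
  "non_lattice_env P a p \<longleftrightarrow>
     (\<forall>\<theta> b :: real. \<exists>n (x :: nat \<Rightarrow> 'x).
        (\<Prod>k<n. P $ x k $ x (Suc k)) * P $ x n $ x 0 > 0 \<and>
        (\<Sum>k\<le>n. log_mean a p (x k)) - real (n + 1) * \<theta> \<notin> range (\<lambda>m :: int. b * of_int m))"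

definition supercritical_env :: "('x \<Rightarrow> real) \<Rightarrow> ('x \<Rightarrow> real) \<Rightarrow> bool" where
  "supercritical_env a p \<longleftrightarrow> (\<forall>i. 0 < a i \<and> a i < p i \<and> p i < 1)"

end

theory Submission
  imports Defs
begin

text \<open>In a fixed environment \<open>x\<close> the law of $Z_n$ is again linear fractional: for $z \ge 1$ its mass at
  $z$ is $q H^{z-1} / (q + H)^{z+1}$ with $q = e^{-S_n}$ and
  $H = \sum_{k<n} e^{-S_k} p_{x_{k+1}} / (1 - a_{x_{k+1}})$. Condition 3 makes every mean larger than 1,
  so $q$ decays geometrically, uniformly in the environment, while $H$ is bounded away from 0. Hence
  $H / (q + H) \to 1$ uniformly, the masses at $1, \ldots, c$ become asymptotically equal, and this
  survives averaging over the paths that end in \<open>j\<close>.\<close>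

section \<open>Power series and generating functions of integer-valued variables\<close>

lemma powser_coeff_unique:
  fixes b c :: "nat \<Rightarrow> real"
  assumes b: "\<And>s. \<bar>s\<bar> < 1 \<Longrightarrow> (\<lambda>k. b k * s ^ k) sums G s"
    and c: "\<And>s. \<bar>s\<bar> < 1 \<Longrightarrow> (\<lambda>k. c k * s ^ k) sums G s"
  shows "b n = c n"
proof (induction n rule: less_induct)
  case (less n)
  define e where "e k = b k - c k" for k
  have e: "(\<lambda>k. e k * s ^ k) sums 0" if "\<bar>s\<bar> < 1" for s
    using sums_diff[OF b c, OF that that] by (simp add: e_def algebra_simps)
  \<comment> \<open>Dividing by \<open>s ^ n\<close> excludes the point 0, where the sought
    coefficient is the value of the series; it is recovered below as the limit at 0.\<close>
  have shifted: "(\<lambda>k. e (k + n) * s ^ k) sums 0" if "s \<noteq> 0" "norm s < 1" for s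
  proof -
    have "(\<Sum>k<n. e k * s ^ k) = 0"
      using less by (intro sum.neutral) (auto simp: e_def)
    hence "(\<lambda>k. e (k + n) * s ^ (k + n)) sums 0"
      using e[of s] that(2) by (subst sums_iff_shift) auto
    from sums_mult[OF this, of "inverse (s ^ n)"] show ?thesis
      using that(1) by (simp add: power_add field_simps)
  qed
  have "((\<lambda>_ :: real. 0 :: real) \<longlongrightarrow> e (0 + n)) (at 0)"
    by (rule powser_limit_0_strong[of 1 "\<lambda>k. e (k + n)"]) (use shifted in auto)
  hence "e n = 0"
    by (simp add: tendsto_const_iff)
  thus ?case by (simp add: e_def)
qed

text \<open>Extends \<open>lf_mass_sums_lf_gen\<close> to negative \<open>s\<close>, needed for
  comparing coefficients, and to \<open>r = 0\<close>, which occurs for the law of generation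
  0.\<close>

lemma lf_mass_sums:
  fixes A r s :: real
  assumes "\<bar>r * s\<bar> < 1"
  shows "(\<lambda>k. lf_mass A r k * s ^ k) sums lf_gen A r s"
proof -
  have "(\<lambda>k. (1 - A) * (1 - r) * s * (r * s) ^ k) sums ((1 - A) * (1 - r) * s * (1 / (1 - r * s)))"
    using assms by (intro sums_mult geometric_sums) auto
  hence "(\<lambda>k. lf_mass A r (Suc k) * s ^ Suc k) sums ((1 - A) * (1 - r) * s * (1 / (1 - r * s)))"
    by (simp add: lf_mass_def power_mult_distrib algebra_simps)
  hence "(\<lambda>k. lf_mass A r k * s ^ k) sums ((1 - A) * (1 - r) * s * (1 / (1 - r * s)) + A)"
    by (subst (asm) sums_Suc_iff) (simp add: lf_mass_def)
  moreover have "1 - r * s \<noteq> 0"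
    using assms by auto
  hence "(1 - A) * (1 - r) * s * (1 / (1 - r * s)) + A = lf_gen A r s"
    by (simp add: lf_gen_def field_simps)
  ultimately show ?thesis by simp
qed

lemma measurable_sum_count_space:
  fixes f :: "'i \<Rightarrow> 'a \<Rightarrow> nat"
  assumes "\<And>l. l \<in> A \<Longrightarrow> f l \<in> measurable N (count_space UNIV)"
  shows "(\<lambda>\<omega>. \<Sum>l\<in>A. f l \<omega>) \<in> measurable N (count_space UNIV)"
  using assms
proof (induction A rule: infinite_finite_induct)
  case (insert l A)
  have [measurable]: "f l \<in> measurable N (count_space UNIV)"
    "(\<lambda>\<omega>. \<Sum>l\<in>A. f l \<omega>) \<in> measurable N (count_space UNIV)"
    using insert by auto
  have "(\<lambda>\<omega>. f l \<omega> + (\<Sum>l\<in>A. f l \<omega>)) \<in> measurable N (count_space UNIV)"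
    by measurable
  thus ?case using insert.hyps by simp
qed simp_all

text \<open>Conditioning on \<open>Z\<close> in series form, by dominated convergence. Keeping
  \<open>Y\<close> separate from \<open>Z\<close> serves two purposes: expanding a generating
  function over its own variable, and splitting generation \<open>n + 1\<close> according to the
  size of generation \<open>n\<close>.\<close>

lemma (in prob_space) expectation_partition_sums:
  fixes Z :: "'a \<Rightarrow> nat" and Y :: "'a \<Rightarrow> real"
  assumes [measurable]: "Z \<in> measurable M (count_space UNIV)" "Y \<in> borel_measurable M"
    and bounded: "\<And>\<omega>. \<omega> \<in> space M \<Longrightarrow> \<bar>Y \<omega>\<bar> \<le> B"
  shows "(\<lambda>k. expectation (\<lambda>\<omega>. if Z \<omega> = k then Y \<omega> else 0)) sums expectation Y"
proof -
  have int: "integrable M (\<lambda>\<omega>. if Z \<omega> = k then Y \<omega> else 0)" for k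
    by (rule integrable_const_bound[where B = "\<bar>B\<bar>"]) (use bounded in \<open>force intro!: AE_I2\<close>)+
  have partial: "(\<Sum>k<N. expectation (\<lambda>\<omega>. if Z \<omega> = k then Y \<omega> else 0)) =
      expectation (\<lambda>\<omega>. if Z \<omega> < N then Y \<omega> else 0)" for N
    by (subst Bochner_Integration.integral_sum[symmetric]) (auto simp: int sum.delta)
  have "(\<lambda>N. expectation (\<lambda>\<omega>. if Z \<omega> < N then Y \<omega> else 0)) \<longlonglongrightarrow> expectation Y"
  proof (rule integral_dominated_convergence[where w = "\<lambda>_. \<bar>B\<bar>"])
    show "AE \<omega> in M. (\<lambda>N. if Z \<omega> < N then Y \<omega> else 0) \<longlonglongrightarrow> Y \<omega>"
    proof (rule AE_I2, rule tendsto_eventually)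
      fix \<omega>
      show "eventually (\<lambda>N. (if Z \<omega> < N then Y \<omega> else 0) = Y \<omega>) sequentially"
        using eventually_gt_at_top[of "Z \<omega>"] by eventually_elim simp
    qed
  qed (use bounded in \<open>force intro!: AE_I2\<close>)+
  thus ?thesis by (simp add: sums_def partial)
qed

lemma (in prob_space) expectation_power_sums:
  fixes Z :: "'a \<Rightarrow> nat" and s :: real
  assumes [measurable]: "Z \<in> measurable M (count_space UNIV)" and "\<bar>s\<bar> \<le> 1"
  shows "(\<lambda>k. \<P>(\<omega> in M. Z \<omega> = k) * s ^ k) sums expectation (\<lambda>\<omega>. s ^ Z \<omega>)"
proof -
  have "expectation (\<lambda>\<omega>. if Z \<omega> = k then s ^ Z \<omega> else 0) = \<P>(\<omega> in M. Z \<omega> = k) * s ^ k" for k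
  proof -
    have "expectation (\<lambda>\<omega>. if Z \<omega> = k then s ^ Z \<omega> else 0) =
        expectation (\<lambda>\<omega>. indicator {\<omega> \<in> space M. Z \<omega> = k} \<omega> * s ^ k)"
      by (intro Bochner_Integration.integral_cong) auto
    thus ?thesis by (simp add: Int_absorb2[OF Collect_restrict])
  qed
  moreover have "\<bar>s ^ Z \<omega>\<bar> \<le> 1" for \<omega>
    using assms(2) by (simp add: power_abs power_le_one)
  hence "(\<lambda>k. expectation (\<lambda>\<omega>. if Z \<omega> = k then s ^ Z \<omega> else 0)) sums expectation (\<lambda>\<omega>. s ^ Z \<omega>)"
    by (intro expectation_partition_sums[where B = 1]) auto
  ultimately show ?thesis by simp
qed

lemma (in prob_space) abs_expectation_power_le_1:
  fixes Z :: "'a \<Rightarrow> nat" and s :: real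
  assumes [measurable]: "Z \<in> measurable M (count_space UNIV)" and "\<bar>s\<bar> \<le> 1"
  shows "\<bar>expectation (\<lambda>\<omega>. s ^ Z \<omega>)\<bar> \<le> 1"
proof -
  have b: "\<bar>s ^ Z \<omega>\<bar> \<le> 1" for \<omega>
    using assms(2) by (simp add: power_abs power_le_one)
  have "\<bar>expectation (\<lambda>\<omega>. s ^ Z \<omega>)\<bar> \<le> expectation (\<lambda>\<omega>. \<bar>s ^ Z \<omega>\<bar>)"
    by simp
  also have "\<dots> \<le> expectation (\<lambda>_. 1)"
    by (intro integral_mono integrable_const_bound[where B = 1] AE_I2) (use b in auto)
  finally show ?thesis by (simp add: prob_space)
qed

text \<open>For \<open>f\<close> linear fractional with mean \<open>m\<close>, \<open>1 / (1 - f s) = (1 / m) / (1 - s) + \<eta>\<close> with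
  \<open>\<eta> = p / (1 - a)\<close>. Iterating along an environment \<open>x\<close> gives
  \<open>1 / (1 - F s) = env_decay / (1 - s) + env_eta\<close>; in the paper's notation
  \<open>env_decay\<close> is $e^{-S_n}$.\<close>

definition env_decay :: "('x \<Rightarrow> real) \<Rightarrow> ('x \<Rightarrow> real) \<Rightarrow> (nat \<Rightarrow> 'x) \<Rightarrow> nat \<Rightarrow> real" where
  "env_decay a p x n = (\<Prod>k=1..n. (1 - p (x k)) / (1 - a (x k)))"

definition env_eta :: "('x \<Rightarrow> real) \<Rightarrow> ('x \<Rightarrow> real) \<Rightarrow> (nat \<Rightarrow> 'x) \<Rightarrow> nat \<Rightarrow> real" where
  "env_eta a p x n = (\<Sum>k<n. env_decay a p x k * (p (x (Suc k)) / (1 - a (x (Suc k)))))"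

section \<open>The law of the process in a fixed environment\<close>

locale lf_family = prob_space M
  for M :: "'w measure" +
  fixes a p :: "'x \<Rightarrow> real" and \<xi> :: "'x \<Rightarrow> nat \<Rightarrow> nat \<Rightarrow> 'w \<Rightarrow> nat"
  assumes a_nonneg: "0 \<le> a i" and a_less_1: "a i < 1" and p_pos: "0 < p i" and p_less_1: "p i < 1"
    and indep: "indep_vars (\<lambda>_. count_space UNIV) (\<lambda>(i, n, l). \<xi> i n l) offspring_index"
    and law: "1 \<le> n \<Longrightarrow> 1 \<le> l \<Longrightarrow> \<P>(\<omega> in M. \<xi> i n l \<omega> = k) = lf_mass (a i) (p i) k"
begin

lemma measurable_offspring:
  assumes "1 \<le> n" "1 \<le> l"
  shows "\<xi> i n l \<in> measurable M (count_space UNIV)"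
  using indep assms by (auto simp: indep_vars_def)

lemma expectation_power_offspring:
  assumes "1 \<le> n" "1 \<le> l" "\<bar>s\<bar> \<le> 1"
  shows "expectation (\<lambda>\<omega>. s ^ \<xi> i n l \<omega>) = lf_gen (a i) (p i) s"
proof -
  have "p i * \<bar>s\<bar> \<le> p i"
    using assms(3) p_pos[of i] by (simp add: mult_left_le)
  hence "\<bar>p i * s\<bar> < 1"
    using p_less_1[of i] p_pos[of i] unfolding abs_mult by linarith
  hence "(\<lambda>k. lf_mass (a i) (p i) k * s ^ k) sums lf_gen (a i) (p i) s"
    by (rule lf_mass_sums)
  moreover have "(\<lambda>k. lf_mass (a i) (p i) k * s ^ k) sums expectation (\<lambda>\<omega>. s ^ \<xi> i n l \<omega>)"
    using expectation_power_sums[OF measurable_offspring[OF assms(1,2), of i] assms(3)]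
    by (simp add: law[OF assms(1,2)])
  ultimately show ?thesis
    by (rule sums_unique2[rotated])
qed

text \<open>\<open>branching (\<lambda>k _. x k) \<xi>\<close> is the process in the deterministic environment \<open>x\<close>. Evaluated on
  coordinate functions it is a measurable function of the generations up to \<open>n\<close>.\<close>

lemma measurable_branching_coords:
  assumes "UNIV \<times> {1..n} \<times> {1..} \<subseteq> K"
  shows "branching (\<lambda>k _. x k) (\<lambda>i n l f. f (i, n, l)) n \<in>
    measurable (PiM K (\<lambda>_. count_space UNIV)) (count_space (UNIV :: nat set))"
  using assms
proof (induction n)
  case (Suc n)
  have [measurable]: "branching (\<lambda>k _. x k) (\<lambda>i n l f. f (i, n, l)) n \<in>
      measurable (PiM K (\<lambda>_. count_space UNIV)) (count_space (UNIV :: nat set))"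
    using Suc.prems by (intro Suc.IH) auto
  have "(\<lambda>f. f (x (Suc n), Suc n, l)) \<in>
      measurable (PiM K (\<lambda>_. count_space UNIV)) (count_space (UNIV :: nat set))" if "1 \<le> l" for l
    using Suc.prems that by (intro measurable_component_singleton) auto
  hence "(\<lambda>f. \<Sum>l=1..m. f (x (Suc n), Suc n, l)) \<in>
      measurable (PiM K (\<lambda>_. count_space UNIV)) (count_space (UNIV :: nat set))" for m :: nat
    by (intro measurable_sum_count_space) simp
  thus ?case
    unfolding branching.simps by (rule measurable_compose_countable) measurable
qed (simp add: fun_eq_iff cong: measurable_cong)

text \<open>\<open>K\<close> is left free because two index sets occur: the generations up to
  \<open>n\<close>, to separate them from generation \<open>n + 1\<close>, and all of
  \<open>offspring_index\<close>, to separate the process from the chain.\<close>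

lemma branching_coords_eq:
  assumes "UNIV \<times> {1..n} \<times> {1..} \<subseteq> K"
  shows "branching (\<lambda>k _. x k) (\<lambda>i n l f. f (i, n, l)) n (\<lambda>(i, n, l)\<in>K. \<xi> i n l \<omega>) =
    branching (\<lambda>k _. x k) \<xi> n \<omega>"
  using assms
proof (induction n)
  case (Suc n)
  have IH: "branching (\<lambda>k _. x k) (\<lambda>i n l f. f (i, n, l)) n (\<lambda>(i, n, l)\<in>K. \<xi> i n l \<omega>) =
      branching (\<lambda>k _. x k) \<xi> n \<omega>"
    using Suc.prems by (intro Suc.IH) auto
  show ?case
    unfolding branching.simps IH using Suc.prems by (intro sum.cong) (auto simp: subset_iff)
qed simp

lemma measurable_branching_det:
  "branching (\<lambda>k _. x k) \<xi> n \<in> measurable M (count_space UNIV)"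
proof (induction n)
  case (Suc n)
  have "(\<lambda>\<omega>. \<Sum>l=1..m. \<xi> (x (Suc n)) (Suc n) l \<omega>) \<in> measurable M (count_space UNIV)" for m
    by (intro measurable_sum_count_space measurable_offspring) auto
  thus ?case
    unfolding branching.simps by (rule measurable_compose_countable) (rule Suc.IH)
qed simp

text \<open>On the level \<open>m\<close> of generation \<open>n\<close> the random number of
  summands is frozen: generation \<open>n + 1\<close> is a sum of \<open>m\<close> offspring
  variables, independent of each other and of the past.\<close>

lemma expectation_power_branching_on_level:
  assumes s: "\<bar>s\<bar> \<le> 1"
  shows "expectation (\<lambda>\<omega>. if branching (\<lambda>k _. x k) \<xi> n \<omega> = m
      then s ^ branching (\<lambda>k _. x k) \<xi> (Suc n) \<omega> else 0) =
    \<P>(\<omega> in M. branching (\<lambda>k _. x k) \<xi> n \<omega> = m) * lf_gen (a (x (Suc n))) (p (x (Suc n))) s ^ m"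
proof -
  \<comment> \<open>Block 0 collects the indices of the past; block \<open>l\<close>, for
    \<open>l\<close> at least 1, is the single index of individual \<open>l\<close> in generation
    \<open>n + 1\<close>. The indicator of the level and the \<open>m\<close> powers of
    \<open>s\<close> thus become \<open>m + 1\<close> factors over disjoint blocks.\<close>
  define K where "K l = (if l = 0 then UNIV \<times> {1..n} \<times> {1..} else {(x (Suc n), Suc n, l)})" for l :: nat
  define Y :: "nat \<Rightarrow> ('x \<times> nat \<times> nat \<Rightarrow> nat) \<Rightarrow> real" where
    "Y l f = (if l = 0 then if branching (\<lambda>k _. x k) (\<lambda>i n l f. f (i, n, l)) n f = m then 1 else 0
       else s ^ f (x (Suc n), Suc n, l))" for l f
  define W where "W l \<omega> = Y l (\<lambda>(i, n, l)\<in>K l. \<xi> i n l \<omega>)" for l \<omega>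
  have "indep_vars (\<lambda>l. PiM (K l) (\<lambda>_. count_space UNIV))
      (\<lambda>l \<omega>. \<lambda>j\<in>K l. (case j of (i, n, l) \<Rightarrow> \<xi> i n l) \<omega>) {0..m}"
    by (rule indep_vars_restrict[OF indep]) (auto simp: K_def disjoint_family_on_def)
  hence "indep_vars (\<lambda>_. borel)
      (\<lambda>l \<omega>. Y l (\<lambda>j\<in>K l. (case j of (i, n, l) \<Rightarrow> \<xi> i n l) \<omega>)) {0..m}"
  proof (rule indep_vars_compose2)
    fix l assume "l \<in> {0..m}"
    show "Y l \<in> borel_measurable (PiM (K l) (\<lambda>_. count_space UNIV))"
    proof (cases "l = 0")
      case True
      have [measurable]: "branching (\<lambda>k _. x k) (\<lambda>i n l f. f (i, n, l)) n \<in>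
          measurable (PiM (K l) (\<lambda>_. count_space UNIV)) (count_space (UNIV :: nat set))"
        by (rule measurable_branching_coords) (simp add: K_def True)
      have "(\<lambda>f. if branching (\<lambda>k _. x k) (\<lambda>i n l f. f (i, n, l)) n f = m then 1 else 0 :: real) \<in>
          borel_measurable (PiM (K l) (\<lambda>_. count_space UNIV))"
        by measurable
      thus ?thesis by (simp add: Y_def[abs_def] True)
    next
      case False
      have [measurable]: "(\<lambda>f. f (x (Suc n), Suc n, l)) \<in>
          measurable (PiM (K l) (\<lambda>_. count_space UNIV)) (count_space (UNIV :: nat set))"
        by (rule measurable_component_singleton) (simp add: K_def False)
      have "(\<lambda>f. s ^ f (x (Suc n), Suc n, l)) \<in> borel_measurable (PiM (K l) (\<lambda>_. count_space UNIV))"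
        by measurable
      thus ?thesis by (simp add: Y_def[abs_def] False)
    qed
  qed
  hence ind: "indep_vars (\<lambda>_. borel) W {0..m}"
    by (simp add: W_def[abs_def] case_prod_unfold)
  have W0: "W 0 \<omega> = (if branching (\<lambda>k _. x k) \<xi> n \<omega> = m then 1 else 0)" for \<omega>
    by (simp add: W_def Y_def K_def branching_coords_eq)
  have W_pos: "W l \<omega> = s ^ \<xi> (x (Suc n)) (Suc n) l \<omega>" if "l \<ge> 1" for l \<omega>
    using that by (simp add: W_def Y_def K_def)
  have int: "integrable M (W l)" if "l \<in> {0..m}" for l
  proof (rule integrable_const_bound[where B = 1])
    show "W l \<in> borel_measurable M"
      using ind that by (simp add: indep_vars_def)
    show "AE \<omega> in M. norm (W l \<omega>) \<le> 1"
      using s by (intro AE_I2, cases "l = 0") (auto simp: W0 W_pos power_abs power_le_one)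
  qed
  have "expectation (\<lambda>\<omega>. if branching (\<lambda>k _. x k) \<xi> n \<omega> = m
      then s ^ branching (\<lambda>k _. x k) \<xi> (Suc n) \<omega> else 0) = expectation (\<lambda>\<omega>. \<Prod>l\<in>{0..m}. W l \<omega>)"
    by (intro Bochner_Integration.integral_cong)
      (auto simp: prod.atLeast_Suc_atMost W0 W_pos power_sum)
  also have "\<dots> = (\<Prod>l\<in>{0..m}. expectation (W l))"
    by (rule indep_vars_lebesgue_integral) (use ind int in auto)
  also have "\<dots> = expectation (W 0) * (\<Prod>l\<in>{1..m}. expectation (W l))"
    by (simp add: prod.atLeast_Suc_atMost)
  also have "expectation (W 0) = expectation (indicator {\<omega> \<in> space M. branching (\<lambda>k _. x k) \<xi> n \<omega> = m})"
    by (intro Bochner_Integration.integral_cong) (auto simp: W0)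
  also have "\<dots> = \<P>(\<omega> in M. branching (\<lambda>k _. x k) \<xi> n \<omega> = m)"
    by (simp add: Int_absorb2[OF Collect_restrict])
  also have "(\<Prod>l\<in>{1..m}. expectation (W l)) = (\<Prod>l\<in>{1..m}. lf_gen (a (x (Suc n))) (p (x (Suc n))) s)"
  proof (rule prod.cong)
    fix l assume "l \<in> {1..m}"
    thus "expectation (W l) = lf_gen (a (x (Suc n))) (p (x (Suc n))) s"
      using expectation_power_offspring[of "Suc n" l s "x (Suc n)"] s W_pos[of l]
      by (simp cong: Bochner_Integration.integral_cong)
  qed simp
  finally show ?thesis by simp
qed

lemma env_decay_pos: "env_decay a p x n > 0"
  unfolding env_decay_def using a_less_1 p_less_1 by (intro prod_pos) simp

lemma env_eta_nonneg: "env_eta a p x n \<ge> 0"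
  unfolding env_eta_def
  by (intro sum_nonneg mult_nonneg_nonneg divide_nonneg_nonneg less_imp_le[OF env_decay_pos])
    (use a_less_1 p_pos in \<open>simp_all add: less_imp_le\<close>)

text \<open>The newest generation is the innermost function of the composition, so the induction
  applies its hypothesis at the point \<open>t\<close>, the image of \<open>s\<close>; hence
  \<open>s\<close> is arbitrary. The formula does not divide by \<open>1 - s\<close> and so includes
  \<open>s = 1\<close>.\<close>

lemma expectation_power_branching_det:
  assumes "\<bar>s\<bar> \<le> 1"
  shows "expectation (\<lambda>\<omega>. s ^ branching (\<lambda>k _. x k) \<xi> n \<omega>) =
    1 - (1 - s) / (env_decay a p x n + env_eta a p x n * (1 - s))"
  using assms
proof (induction n arbitrary: s)
  case 0
  show ?case by (simp add: env_decay_def env_eta_def prob_space)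
next
  case (Suc n)
  define A where "A = a (x (Suc n))"
  define r where "r = p (x (Suc n))"
  define q where "q = env_decay a p x n"
  define H where "H = env_eta a p x n"
  define t where "t = lf_gen A r s"
  \<comment> \<open>As the expectation of a power of \<open>s\<close>, \<open>t\<close> lies in the
    range of the induction hypothesis; no estimate of \<open>lf_gen\<close> at negative arguments is
    required.\<close>
  have t: "\<bar>t\<bar> \<le> 1"
    using abs_expectation_power_le_1[OF measurable_offspring Suc.prems, of 1 1 "x (Suc n)"]
    by (simp add: expectation_power_offspring Suc.prems t_def A_def r_def)
  have meas [measurable]: "branching (\<lambda>k _. x k) \<xi> n \<in> measurable M (count_space UNIV)" for n
    by (rule measurable_branching_det)
  have "\<bar>s ^ branching (\<lambda>k _. x k) \<xi> (Suc n) \<omega>\<bar> \<le> 1" for \<omega>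
    unfolding power_abs using Suc.prems by (intro power_le_one) auto
  hence "(\<lambda>m. expectation (\<lambda>\<omega>. if branching (\<lambda>k _. x k) \<xi> n \<omega> = m
      then s ^ branching (\<lambda>k _. x k) \<xi> (Suc n) \<omega> else 0)) sums
    expectation (\<lambda>\<omega>. s ^ branching (\<lambda>k _. x k) \<xi> (Suc n) \<omega>)"
    by (intro expectation_partition_sums[where B = 1]) (auto simp del: branching.simps)
  hence "(\<lambda>m. \<P>(\<omega> in M. branching (\<lambda>k _. x k) \<xi> n \<omega> = m) * t ^ m) sums
    expectation (\<lambda>\<omega>. s ^ branching (\<lambda>k _. x k) \<xi> (Suc n) \<omega>)"
    unfolding expectation_power_branching_on_level[OF Suc.prems] t_def A_def r_def .
  from this expectation_power_sums[OF meas t, of n]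
  have "expectation (\<lambda>\<omega>. s ^ branching (\<lambda>k _. x k) \<xi> (Suc n) \<omega>) =
      expectation (\<lambda>\<omega>. t ^ branching (\<lambda>k _. x k) \<xi> n \<omega>)"
    by (rule sums_unique2)
  also have "\<dots> = 1 - (1 - t) / (q + H * (1 - t))"
    using Suc.IH[OF t] by (simp add: q_def H_def)
  also have "(1 - t) / (q + H * (1 - t)) =
      (1 - s) / (q * ((1 - r) / (1 - A)) + (H + q * (r / (1 - A))) * (1 - s))"
  proof -
    have pos: "1 - A > 0" "r > 0" "1 - r > 0" "q > 0" "H \<ge> 0" "1 - s \<ge> 0"
      using a_less_1 p_less_1 p_pos env_decay_pos env_eta_nonneg Suc.prems
      by (simp_all add: A_def r_def q_def H_def)
    \<comment> \<open>\<open>D\<close> is the denominator of \<open>lf_gen\<close>, written as a sum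
      with positive first term so that its sign is evident. Numerator and denominator of the left
      side are multiplied by \<open>D\<close>.\<close>
    define u where "u = 1 - s"
    define D where "D = (1 - r) + r * u"
    have D: "1 - r * s = D"
      by (simp add: D_def u_def algebra_simps)
    have D_pos: "D > 0"
      unfolding D_def u_def using pos by (intro add_pos_nonneg mult_nonneg_nonneg) auto
    have "1 - t = (1 - A) * u / D"
      by (simp add: t_def lf_gen_def D u_def)
    moreover have "q * D + H * ((1 - A) * u) > 0"
      using pos D_pos by (intro add_pos_nonneg mult_pos_pos mult_nonneg_nonneg) (auto simp: u_def)
    moreover have "q + H * ((1 - A) * u / D) = (q * D + H * ((1 - A) * u)) / D"
      using D_pos by (simp add: add_divide_distrib)
    ultimately have "(1 - t) / (q + H * (1 - t)) = (1 - A) * u / (q * D + H * ((1 - A) * u))"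
      using D_pos by simp
    moreover
    \<comment> \<open>\<open>B\<close> keeps \<open>1 - A\<close> as one atom while denominators are
      cleared.\<close>
    have "q * D + H * (B * u) = B * (q * ((1 - r) / B) + (H + q * (r / B)) * u)" if "B > 0" for B
      using that by (simp add: D_def field_simps)
    from this[of "1 - A"] have "q * D + H * ((1 - A) * u) =
        (1 - A) * (q * ((1 - r) / (1 - A)) + (H + q * (r / (1 - A))) * u)"
      using pos by simp
    ultimately show ?thesis using pos by (simp add: u_def)
  qed
  finally show ?case
    by (simp add: env_decay_def env_eta_def q_def H_def A_def r_def)
qed

text \<open>The closed form is again some \<open>lf_gen A r\<close>, so its coefficients are those
  of \<open>lf_mass A r\<close>.\<close>

lemma prob_branching_det:
  fixes x :: "nat \<Rightarrow> 'x" and n z :: nat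
  assumes "z \<ge> 1"
  defines "q \<equiv> env_decay a p x n" and "H \<equiv> env_eta a p x n"
  shows "\<P>(\<omega> in M. branching (\<lambda>k _. x k) \<xi> n \<omega> = z) =
    q / (q + H) ^ 2 * (H / (q + H)) ^ (z - 1)"
proof -
  have q: "q > 0" and H: "H \<ge> 0"
    by (simp_all add: q_def H_def env_decay_pos env_eta_nonneg)
  \<comment> \<open>\<open>A\<close> is the closed form at \<open>s = 0\<close>, that is, the
    extinction probability by time \<open>n\<close>. \<open>r\<close> comes from factoring the
    denominator: q + H (1 - s) = (q + H) (1 - r s).\<close>
  define A where "A = 1 - 1 / (q + H)"
  define r where "r = H / (q + H)"
  have r: "0 \<le> r" "r < 1"
    using q H by (simp_all add: r_def)
  have gen: "expectation (\<lambda>\<omega>. s ^ branching (\<lambda>k _. x k) \<xi> n \<omega>) = lf_gen A r s" if "\<bar>s\<bar> < 1" for s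
  proof -
    have "1 - r * s = (q + H * (1 - s)) / (q + H)"
      using q H by (simp add: r_def field_simps)
    hence "lf_gen A r s = 1 - (1 - s) / (q + H * (1 - s))"
      using q H by (simp add: lf_gen_def A_def)
    thus ?thesis
      using expectation_power_branching_det[of s x n] that by (simp add: q_def H_def)
  qed
  have "\<P>(\<omega> in M. branching (\<lambda>k _. x k) \<xi> n \<omega> = z) = lf_mass A r z"
  proof (rule powser_coeff_unique)
    fix s :: real assume s: "\<bar>s\<bar> < 1"
    show "(\<lambda>k. \<P>(\<omega> in M. branching (\<lambda>k _. x k) \<xi> n \<omega> = k) * s ^ k) sums lf_gen A r s"
      using expectation_power_sums[OF measurable_branching_det, of s x n] s by (simp add: gen)
    have "\<bar>r\<bar> * \<bar>s\<bar> < 1 * 1"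
      using r s by (intro mult_strict_mono') auto
    thus "(\<lambda>k. lf_mass A r k * s ^ k) sums lf_gen A r s"
      by (intro lf_mass_sums) (simp add: abs_mult)
  qed
  also have "1 - r = q / (q + H)"
    using q H by (simp add: r_def field_simps)
  hence "lf_mass A r z = q / (q + H) ^ 2 * r ^ (z - 1)"
    using assms(1) by (simp add: lf_mass_def A_def power2_eq_square)
  finally show ?thesis by (simp add: r_def)
qed

section \<open>Bounds uniform in the environment\<close>

lemma env_decay_le:
  assumes "\<And>i. (1 - p i) / (1 - a i) \<le> \<theta>"
  shows "env_decay a p x n \<le> \<theta> ^ n"
proof -
  have "env_decay a p x n \<le> (\<Prod>k=1..n. \<theta>)"
    unfolding env_decay_def using assms a_less_1 p_less_1 by (intro prod_mono) (simp add: less_imp_le)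
  thus ?thesis by simp
qed

text \<open>The summand \<open>k = 0\<close>, whose decay factor is the empty product 1, suffices;
  it is present because \<open>n\<close> is at least 1.\<close>

lemma env_eta_ge:
  assumes "\<And>i. \<eta> \<le> p i / (1 - a i)" and "n \<ge> 1"
  shows "\<eta> \<le> env_eta a p x n"
proof -
  have "\<eta> \<le> env_decay a p x 0 * (p (x (Suc 0)) / (1 - a (x (Suc 0))))"
    using assms(1) by (simp add: env_decay_def)
  also have "\<dots> \<le> env_eta a p x n"
    unfolding env_eta_def
    by (rule member_le_sum)
      (use assms(2) env_decay_pos a_less_1 p_pos in \<open>simp_all add: less_imp_le\<close>)
  finally show ?thesis .
qed

lemma prob_branching_det_pos: "\<P>(\<omega> in M. branching (\<lambda>k _. x k) \<xi> n \<omega> = 1) > 0"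
  using env_decay_pos[of x n] env_eta_nonneg[of x n]
  by (subst prob_branching_det) (auto intro!: divide_pos_pos)

text \<open>From 1 on, the masses form a geometric sequence with ratio H / (q + H) below 1.\<close>

lemma prob_branching_det_le:
  assumes "z \<ge> 1"
  shows "\<P>(\<omega> in M. branching (\<lambda>k _. x k) \<xi> n \<omega> = z) \<le>
    \<P>(\<omega> in M. branching (\<lambda>k _. x k) \<xi> n \<omega> = 1)"
proof -
  have "(env_eta a p x n / (env_decay a p x n + env_eta a p x n)) ^ (z - 1) \<le> 1"
    using env_decay_pos[of x n] env_eta_nonneg[of x n] by (intro power_le_one) auto
  hence "env_decay a p x n / (env_decay a p x n + env_eta a p x n) ^ 2 *
      (env_eta a p x n / (env_decay a p x n + env_eta a p x n)) ^ (z - 1) \<le>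
      env_decay a p x n / (env_decay a p x n + env_eta a p x n) ^ 2"
    using env_decay_pos[of x n] env_eta_nonneg[of x n] by (intro mult_left_le) auto
  thus ?thesis
    using assms by (simp add: prob_branching_det)
qed

text \<open>The geometric ratio is 1 / (1 + q / H), and q / H is at most
  \<open>\<theta> ^ n / \<eta>\<close>, a bound free of \<open>x\<close>.\<close>

lemma prob_branching_det_ge:
  assumes \<theta>: "\<And>i. (1 - p i) / (1 - a i) \<le> \<theta>"
    and \<eta>: "\<And>i. \<eta> \<le> p i / (1 - a i)" "0 < \<eta>" and "n \<ge> 1" "z \<ge> 1"
  shows "(1 / (1 + \<theta> ^ n / \<eta>)) ^ (z - 1) * \<P>(\<omega> in M. branching (\<lambda>k _. x k) \<xi> n \<omega> = 1) \<le>
    \<P>(\<omega> in M. branching (\<lambda>k _. x k) \<xi> n \<omega> = z)"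
proof -
  define q where "q = env_decay a p x n"
  define H where "H = env_eta a p x n"
  have q: "0 < q" "q \<le> \<theta> ^ n"
    using env_decay_pos env_decay_le[OF \<theta>] by (simp_all add: q_def)
  have H: "\<eta> \<le> H"
    using env_eta_ge[OF \<eta>(1) assms(4)] by (simp add: H_def)
  have "q / H \<le> \<theta> ^ n / \<eta>"
    using q H \<eta>(2) by (intro frac_le) auto
  hence "1 / (1 + \<theta> ^ n / \<eta>) \<le> 1 / (1 + q / H)"
    using q H \<eta>(2) by (intro divide_left_mono) (auto intro!: mult_pos_pos add_pos_pos)
  also have "\<dots> = H / (q + H)"
    using q H \<eta>(2) by (simp add: field_simps)
  finally have "(1 / (1 + \<theta> ^ n / \<eta>)) ^ (z - 1) \<le> (H / (q + H)) ^ (z - 1)"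
    using q \<eta>(2) by (intro power_mono) auto
  from mult_right_mono[OF this, of "q / (q + H) ^ 2"] show ?thesis
    using q assms(5) by (simp add: prob_branching_det q_def H_def mult.commute)
qed

end

section \<open>Averaging over the paths of the chain\<close>

lemma branching_cong:
  assumes "\<And>k. k \<in> {1..n} \<Longrightarrow> X k \<omega> = x k"
  shows "branching X \<xi> n \<omega> = branching (\<lambda>k _. x k) \<xi> n \<omega>"
  using assms by (induction n) auto

text \<open>Paths are coded by extensional functions on \<open>{..n}\<close>: the code set is
  finite, and each trajectory has exactly one code.\<close>

lemma (in prob_space) prob_sum_paths:
  fixes X :: "nat \<Rightarrow> 'a \<Rightarrow> 'x::finite"
  assumes [measurable]: "\<And>n. X n \<in> measurable M (count_space UNIV)" "{\<omega>\<in>space M. Q \<omega>} \<in> events"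
  shows "\<P>(\<omega> in M. Q \<omega>) = (\<Sum>x\<in>PiE {..n} (\<lambda>_. UNIV). \<P>(\<omega> in M. Q \<omega> \<and> (\<forall>k\<le>n. X k \<omega> = x k)))"
proof (rule prob_sum)
  show "finite (PiE {..n} (\<lambda>_. UNIV :: 'x set))"
    by (intro finite_PiE) auto
  show "AE \<omega> in M. (\<forall>x\<in>PiE {..n} (\<lambda>_. UNIV). Q \<omega> \<and> (\<forall>k\<le>n. X k \<omega> = x k) \<longrightarrow> Q \<omega>) \<and>
      (Q \<omega> \<longrightarrow> (\<exists>!x\<in>PiE {..n} (\<lambda>_. UNIV). Q \<omega> \<and> (\<forall>k\<le>n. X k \<omega> = x k)))"
  proof (intro AE_I2 conjI impI)
    fix \<omega> assume "Q \<omega>"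
    show "\<exists>!x\<in>PiE {..n} (\<lambda>_. UNIV). Q \<omega> \<and> (\<forall>k\<le>n. X k \<omega> = x k)"
      by (rule ex1I[where a = "\<lambda>k\<in>{..n}. X k \<omega>"])
        (use \<open>Q \<omega>\<close> in \<open>auto simp: PiE_def extensional_def fun_eq_iff\<close>)
  qed auto
  show "{\<omega>\<in>space M. Q \<omega> \<and> (\<forall>k\<le>n. X k \<omega> = x k)} \<in> events" for x
    by measurable
qed (fact assms(2))

locale lf_branching_process = lf_family M a p \<xi>
  for M :: "'w measure" and a p :: "'x::finite \<Rightarrow> real" and \<xi> +
  fixes P :: "real^'x^'x" and i :: 'x and X :: "nat \<Rightarrow> 'w \<Rightarrow> 'x"
  assumes stochastic: "stochastic_matrix P"
    and chain: "markov_chain_from P i M X"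
    and family: "lf_offspring_family a p M X \<xi>"
begin

lemma measurable_chain [measurable]: "X n \<in> measurable M (count_space UNIV)"
  using chain by (auto simp: markov_chain_from_def)

lemma measurable_branching [measurable]: "branching X \<xi> n \<in> measurable M (count_space UNIV)"
proof (induction n)
  case (Suc n)
  have "(\<lambda>\<omega>. \<Sum>l=1..m. \<xi> y (Suc n) l \<omega>) \<in> measurable M (count_space UNIV)" for m y
    by (intro measurable_sum_count_space measurable_offspring) auto
  hence "(\<lambda>\<omega>. \<Sum>l=1..m. \<xi> (X (Suc n) \<omega>) (Suc n) l \<omega>) \<in> measurable M (count_space UNIV)" for m
    by (rule measurable_compose_countable) measurable
  thus ?case
    unfolding branching.simps by (rule measurable_compose_countable) (rule Suc.IH)
qed (simp add: fun_eq_iff cong: measurable_cong)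

lemma prob_chain_Suc:
  "\<P>(\<omega> in M. X (Suc n) \<omega> = y) = (\<Sum>j\<in>UNIV. \<P>(\<omega> in M. X n \<omega> = j) * P $ j $ y)"
proof -
  define path where "path x = \<P>(\<omega> in M. \<forall>k\<le>n. X k \<omega> = x k)" for x
  \<comment> \<open>The Markov property is only given for pasts of positive probability. For a null
    past both sides vanish.\<close>
  have step: "\<P>(\<omega> in M. X (Suc n) \<omega> = y \<and> (\<forall>k\<le>n. X k \<omega> = x k)) = path x * P $ x n $ y" for x
  proof (cases "path x > 0")
    case True
    with chain have "\<P>(\<omega> in M. X (Suc n) \<omega> = y \<bar> \<forall>k\<le>n. X k \<omega> = x k) = P $ x n $ y"
      by (auto simp: markov_chain_from_def path_def)
    with True show ?thesis
      by (simp add: cond_prob_def path_def field_simps)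
  next
    case False
    hence "path x = 0" by (simp add: path_def not_less measure_le_0_iff)
    moreover have "\<P>(\<omega> in M. X (Suc n) \<omega> = y \<and> (\<forall>k\<le>n. X k \<omega> = x k)) \<le> path x"
      unfolding path_def by (intro finite_measure_mono) auto
    ultimately show ?thesis by (simp add: measure_le_0_iff)
  qed
  have marg: "\<P>(\<omega> in M. X n \<omega> = j) = (\<Sum>x\<in>PiE {..n} (\<lambda>_. UNIV). if x n = j then path x else 0)" for j
  proof (subst prob_sum_paths[where X = X and n = n], (measurable)[2], rule sum.cong)
    fix x :: "nat \<Rightarrow> 'x"
    have "{\<omega> \<in> space M. X n \<omega> = j \<and> (\<forall>k\<le>n. X k \<omega> = x k)} =
        (if x n = j then {\<omega> \<in> space M. \<forall>k\<le>n. X k \<omega> = x k} else {})"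
      by auto
    thus "\<P>(\<omega> in M. X n \<omega> = j \<and> (\<forall>k\<le>n. X k \<omega> = x k)) = (if x n = j then path x else 0)"
      by (simp add: path_def)
  qed simp
  have "\<P>(\<omega> in M. X (Suc n) \<omega> = y) = (\<Sum>x\<in>PiE {..n} (\<lambda>_. UNIV). path x * P $ x n $ y)"
    by (subst prob_sum_paths[where X = X and n = n]) (simp_all add: step)
  also have "\<dots> = (\<Sum>x\<in>PiE {..n} (\<lambda>_. UNIV). \<Sum>j\<in>UNIV. (if x n = j then path x else 0) * P $ j $ y)"
    by (intro sum.cong) (simp_all add: if_distrib[of "\<lambda>u. u * _"] cong: if_cong)
  also have "\<dots> = (\<Sum>j\<in>UNIV. \<Sum>x\<in>PiE {..n} (\<lambda>_. UNIV). (if x n = j then path x else 0) * P $ j $ y)"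
    by (rule sum.swap)
  finally show ?thesis
    by (simp add: marg sum_distrib_right)
qed

text \<open>Peeling off the last transition replaces \<open>g\<close> by \<open>P *v g\<close>, so
  the induction needs arbitrary \<open>g\<close>. The right side has the shape in which
  \<open>primitive_env\<close> speaks about \<open>P\<close>.\<close>

lemma expectation_chain:
  "(\<Sum>j\<in>UNIV. \<P>(\<omega> in M. X n \<omega> = j) * g $ j) = ((*v) P ^^ n) g $ i"
proof (induction n arbitrary: g)
  case 0
  have "\<P>(\<omega> in M. X 0 \<omega> = j) = (if j = i then 1 else 0)" for j
  proof (cases "j = i")
    case True
    thus ?thesis using chain by (simp add: markov_chain_from_def prob_Collect_eq_1)
  next
    case False
    have "AE \<omega> in M. \<not> X 0 \<omega> = j"
      using chain False by (auto simp: markov_chain_from_def elim: eventually_mono)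
    thus ?thesis using False by (simp add: prob_Collect_eq_0)
  qed
  thus ?case by (simp add: if_distrib[of "\<lambda>u. u * _"] cong: if_cong)
next
  case (Suc n)
  have "(\<Sum>y\<in>UNIV. \<P>(\<omega> in M. X (Suc n) \<omega> = y) * g $ y) =
      (\<Sum>y\<in>UNIV. \<Sum>j\<in>UNIV. \<P>(\<omega> in M. X n \<omega> = j) * (P $ j $ y * g $ y))"
    by (simp add: prob_chain_Suc sum_distrib_right mult.assoc)
  also have "\<dots> = (\<Sum>j\<in>UNIV. \<Sum>y\<in>UNIV. \<P>(\<omega> in M. X n \<omega> = j) * (P $ j $ y * g $ y))"
    by (rule sum.swap)
  also have "\<dots> = (\<Sum>j\<in>UNIV. \<P>(\<omega> in M. X n \<omega> = j) * (P *v g) $ j)"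
    by (simp add: matrix_vector_mult_def sum_distrib_left)
  also have "\<dots> = ((*v) P ^^ n) (P *v g) $ i"
    by (rule Suc.IH)
  finally show ?case by (simp add: funpow_swap1)
qed

lemma prob_chain_eq: "\<P>(\<omega> in M. X n \<omega> = j) = ((*v) P ^^ n) (axis j 1) $ i"
  using expectation_chain[of n "axis j 1"]
  by (simp add: axis_def if_distrib[of "\<lambda>u. _ * u"] cong: if_cong)

text \<open>With \<open>x\<close> constant, the first event depends on the chain alone and the
  second on the offspring family alone. Each is exhibited as a preimage in one of the two generated
  sigma-algebras assumed independent.\<close>

lemma indep_chain_branching_det:
  "\<P>(\<omega> in M. (\<forall>k\<le>n. X k \<omega> = x k) \<and> branching (\<lambda>k _. x k) \<xi> n \<omega> = z) =
    \<P>(\<omega> in M. \<forall>k\<le>n. X k \<omega> = x k) * \<P>(\<omega> in M. branching (\<lambda>k _. x k) \<xi> n \<omega> = z)"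
proof -
  let ?C = "PiM UNIV (\<lambda>_. count_space UNIV) :: (nat \<Rightarrow> 'x) measure"
  let ?F = "PiM offspring_index (\<lambda>_. count_space UNIV) :: ('x \<times> nat \<times> nat \<Rightarrow> nat) measure"
  let ?\<xi> = "\<lambda>\<omega>. \<lambda>(i, n, l)\<in>offspring_index. \<xi> i n l \<omega>"
  let ?Z = "branching (\<lambda>k _. x k) (\<lambda>i n l f. f (i, n, l)) n"
  have "{f \<in> space ?C. \<forall>k\<le>n. f k = x k} \<in> sets ?C"
    by measurable
  hence "(\<lambda>\<omega> n. X n \<omega>) -` {f \<in> space ?C. \<forall>k\<le>n. f k = x k} \<inter> space M \<in>
      sets (vimage_algebra (space M) (\<lambda>\<omega> n. X n \<omega>) ?C)"
    by (rule in_vimage_algebra)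
  also have "(\<lambda>\<omega> n. X n \<omega>) -` {f \<in> space ?C. \<forall>k\<le>n. f k = x k} \<inter> space M =
      {\<omega> \<in> space M. \<forall>k\<le>n. X k \<omega> = x k}"
    by (auto simp: space_PiM)
  finally have chain_ev: "{\<omega> \<in> space M. \<forall>k\<le>n. X k \<omega> = x k} \<in>
      sets (vimage_algebra (space M) (\<lambda>\<omega> n. X n \<omega>) ?C)" .
  have [measurable]: "?Z \<in> measurable ?F (count_space UNIV)"
    by (rule measurable_branching_coords) auto
  have "{f \<in> space ?F. ?Z f = z} \<in> sets ?F"
    by measurable
  hence "?\<xi> -` {f \<in> space ?F. ?Z f = z} \<inter> space M \<in> sets (vimage_algebra (space M) ?\<xi> ?F)"
    by (rule in_vimage_algebra)
  also have "?\<xi> -` {f \<in> space ?F. ?Z f = z} \<inter> space M =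
      {\<omega> \<in> space M. branching (\<lambda>k _. x k) \<xi> n \<omega> = z}"
  proof -
    have "?Z (?\<xi> \<omega>) = branching (\<lambda>k _. x k) \<xi> n \<omega>" for \<omega>
      by (rule branching_coords_eq) auto
    thus ?thesis by (auto simp: space_PiM)
  qed
  finally have fam_ev: "{\<omega> \<in> space M. branching (\<lambda>k _. x k) \<xi> n \<omega> = z} \<in>
      sets (vimage_algebra (space M) ?\<xi> ?F)" .
  have "indep_set (sets (vimage_algebra (space M) (\<lambda>\<omega> n. X n \<omega>) ?C))
      (sets (vimage_algebra (space M) ?\<xi> ?F))"
    using family by (simp add: lf_offspring_family_def)
  from indep_setD[OF this chain_ev fam_ev]
  have "prob ({\<omega> \<in> space M. \<forall>k\<le>n. X k \<omega> = x k} \<inter> {\<omega> \<in> space M. branching (\<lambda>k _. x k) \<xi> n \<omega> = z}) =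
      \<P>(\<omega> in M. \<forall>k\<le>n. X k \<omega> = x k) * \<P>(\<omega> in M. branching (\<lambda>k _. x k) \<xi> n \<omega> = z)" .
  moreover have "{\<omega> \<in> space M. \<forall>k\<le>n. X k \<omega> = x k} \<inter> {\<omega> \<in> space M. branching (\<lambda>k _. x k) \<xi> n \<omega> = z} =
      {\<omega> \<in> space M. (\<forall>k\<le>n. X k \<omega> = x k) \<and> branching (\<lambda>k _. x k) \<xi> n \<omega> = z}"
    by blast
  ultimately show ?thesis by simp
qed

text \<open>Along a given path the process coincides with its fixed-environment version, and
  independence then factors each term. The result is a mixture whose weights do not involve
  \<open>z\<close>, so bounds between masses carry over term by term.\<close>

lemma prob_branching_chain:
  "\<P>(\<omega> in M. branching X \<xi> n \<omega> = z \<and> X n \<omega> = j) =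
    (\<Sum>x\<in>{x \<in> PiE {..n} (\<lambda>_. UNIV). x n = j}. \<P>(\<omega> in M. \<forall>k\<le>n. X k \<omega> = x k) *
       \<P>(\<omega> in M. branching (\<lambda>k _. x k) \<xi> n \<omega> = z))"
proof -
  have "\<P>(\<omega> in M. (branching X \<xi> n \<omega> = z \<and> X n \<omega> = j) \<and> (\<forall>k\<le>n. X k \<omega> = x k)) =
      (if x n = j then \<P>(\<omega> in M. \<forall>k\<le>n. X k \<omega> = x k) *
         \<P>(\<omega> in M. branching (\<lambda>k _. x k) \<xi> n \<omega> = z) else 0)" for x
  proof -
    have "branching X \<xi> n \<omega> = branching (\<lambda>k _. x k) \<xi> n \<omega>" if "\<forall>k\<le>n. X k \<omega> = x k" for \<omega>
      using that by (intro branching_cong) auto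
    hence "{\<omega> \<in> space M. (branching X \<xi> n \<omega> = z \<and> X n \<omega> = j) \<and> (\<forall>k\<le>n. X k \<omega> = x k)} =
        (if x n = j then {\<omega> \<in> space M. (\<forall>k\<le>n. X k \<omega> = x k) \<and> branching (\<lambda>k _. x k) \<xi> n \<omega> = z}
         else {})"
      by auto
    thus ?thesis by (simp add: indep_chain_branching_det)
  qed
  thus ?thesis
    by (subst prob_sum_paths[where X = X and n = n]) (simp_all add: sum.inter_filter finite_PiE)
qed

text \<open>Some path ending in \<open>j\<close> has positive probability, and in every fixed
  environment the value 1 does too; the term of that path makes the sum positive.\<close>

lemma prob_branching_chain_pos:
  assumes "\<P>(\<omega> in M. X n \<omega> = j) > 0"
  shows "\<P>(\<omega> in M. branching X \<xi> n \<omega> = 1 \<and> X n \<omega> = j) > 0"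
proof -
  have "\<exists>x\<in>PiE {..n} (\<lambda>_. UNIV). \<P>(\<omega> in M. X n \<omega> = j \<and> (\<forall>k\<le>n. X k \<omega> = x k)) \<noteq> 0"
  proof (rule ccontr)
    assume none: "\<not> ?thesis"
    have "\<P>(\<omega> in M. X n \<omega> = j) =
        (\<Sum>x\<in>PiE {..n} (\<lambda>_. UNIV). \<P>(\<omega> in M. X n \<omega> = j \<and> (\<forall>k\<le>n. X k \<omega> = x k)))"
      by (rule prob_sum_paths[where X = X and Q = "\<lambda>\<omega>. X n \<omega> = j"]) measurable
    also have "\<dots> = 0"
      using none by (intro sum.neutral) blast
    finally show False using assms by simp
  qed
  then obtain x where x: "x \<in> PiE {..n} (\<lambda>_. UNIV)"
    and nz: "\<P>(\<omega> in M. X n \<omega> = j \<and> (\<forall>k\<le>n. X k \<omega> = x k)) \<noteq> 0"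
    by blast
  have xn: "x n = j"
  proof (rule ccontr)
    assume "x n \<noteq> j"
    hence "{\<omega> \<in> space M. X n \<omega> = j \<and> (\<forall>k\<le>n. X k \<omega> = x k)} = {}"
      by auto
    with nz show False by simp
  qed
  hence "{\<omega> \<in> space M. X n \<omega> = j \<and> (\<forall>k\<le>n. X k \<omega> = x k)} = {\<omega> \<in> space M. \<forall>k\<le>n. X k \<omega> = x k}"
    by auto
  with nz have "\<P>(\<omega> in M. \<forall>k\<le>n. X k \<omega> = x k) > 0"
    by (simp add: zero_less_measure_iff)
  with x xn show ?thesis
    unfolding prob_branching_chain
    by (intro sum_pos2[where i = x] mult_pos_pos prob_branching_det_pos) (auto simp: finite_PiE)
qed

lemma prob_branching_chain_le:
  assumes "z \<ge> 1"
  shows "\<P>(\<omega> in M. branching X \<xi> n \<omega> = z \<and> X n \<omega> = j) \<le>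
    \<P>(\<omega> in M. branching X \<xi> n \<omega> = 1 \<and> X n \<omega> = j)"
  unfolding prob_branching_chain
  by (intro sum_mono mult_left_mono prob_branching_det_le assms measure_nonneg)

lemma prob_branching_chain_ge:
  assumes "\<And>i. (1 - p i) / (1 - a i) \<le> \<theta>" "\<And>i. \<eta> \<le> p i / (1 - a i)" "0 < \<eta>" "n \<ge> 1" "z \<ge> 1"
  shows "(1 / (1 + \<theta> ^ n / \<eta>)) ^ (z - 1) * \<P>(\<omega> in M. branching X \<xi> n \<omega> = 1 \<and> X n \<omega> = j) \<le>
    \<P>(\<omega> in M. branching X \<xi> n \<omega> = z \<and> X n \<omega> = j)"
  unfolding prob_branching_chain sum_distrib_left mult.left_commute[of "(1 / (1 + \<theta> ^ n / \<eta>)) ^ (z - 1)"]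
  by (intro sum_mono mult_left_mono prob_branching_det_ge assms measure_nonneg)

text \<open>Also valid when the conditioning event is null, both sides then being quotients by
  0.\<close>

lemma cond_prob_branching_eq:
  assumes "z \<in> {1..c}"
  shows "\<P>(\<omega> in M. branching X \<xi> n \<omega> = z \<bar>
      1 \<le> branching X \<xi> n \<omega> \<and> branching X \<xi> n \<omega> \<le> c \<and> X n \<omega> = j) =
    \<P>(\<omega> in M. branching X \<xi> n \<omega> = z \<and> X n \<omega> = j) /
    (\<Sum>y\<in>{1..c}. \<P>(\<omega> in M. branching X \<xi> n \<omega> = y \<and> X n \<omega> = j))"
proof -
  have "\<P>(\<omega> in M. 1 \<le> branching X \<xi> n \<omega> \<and> branching X \<xi> n \<omega> \<le> c \<and> X n \<omega> = j) =
      (\<Sum>y\<in>{1..c}. \<P>(\<omega> in M. branching X \<xi> n \<omega> = y \<and> X n \<omega> = j))"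
    by (rule prob_sum) (auto intro!: AE_I2)
  moreover have "{\<omega> \<in> space M. branching X \<xi> n \<omega> = z \<and>
      1 \<le> branching X \<xi> n \<omega> \<and> branching X \<xi> n \<omega> \<le> c \<and> X n \<omega> = j} =
      {\<omega> \<in> space M. branching X \<xi> n \<omega> = z \<and> X n \<omega> = j}"
    using assms by auto
  ultimately show ?thesis by (simp add: cond_prob_def)
qed

end

section \<open>Positivity of the chain at large times, and the limit\<close>

lemma stochastic_matrix_vector_pos:
  assumes "stochastic_matrix P" and "\<And>i. g $ i > 0"
  shows "(P *v g) $ i > 0"
proof -
  have nonneg: "\<forall>j. P $ i $ j \<ge> 0" and row: "(\<Sum>j\<in>UNIV. P $ i $ j) = 1"
    using assms(1) by (auto simp: stochastic_matrix_def)
  have "\<exists>j. P $ i $ j \<noteq> 0"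
    using row by (metis sum.neutral zero_neq_one)
  then obtain j where "P $ i $ j > 0"
    using nonneg by (metis order_le_less)
  thus ?thesis
    unfolding matrix_vector_mult_def using nonneg assms(2)
    by (auto intro!: sum_pos2[where i = j] mult_nonneg_nonneg simp: less_imp_le)
qed

text \<open>Primitivity gives positivity at the single exponent \<open>k0\<close>; each further
  factor preserves it because every row of a stochastic matrix has a positive entry. This makes
  every state \<open>j\<close> reachable at all large times, so that the mass at 1 can serve as a
  divisor.\<close>

lemma primitive_env_eventually_pos:
  assumes "primitive_env P" "stochastic_matrix P"
  shows "\<forall>\<^sub>F n in sequentially. \<forall>i. ((*v) P ^^ n) (axis j 1) $ i > 0"
proof -
  obtain k0 where k0: "\<And>g i. (\<forall>i. 0 \<le> g $ i) \<Longrightarrow> g \<noteq> 0 \<Longrightarrow> ((*v) P ^^ k0) g $ i > 0"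
    using assms(1) unfolding primitive_env_def by blast
  have "((*v) P ^^ (m + k0)) (axis j 1) $ i > 0" for m i
  proof (induction m arbitrary: i)
    case 0
    show ?case by (simp, rule k0) (auto simp: axis_def vec_eq_iff)
  next
    case (Suc m)
    show ?case using stochastic_matrix_vector_pos[OF assms(2) Suc.IH] by simp
  qed
  hence "\<forall>i. ((*v) P ^^ n) (axis j 1) $ i > 0" if "n \<ge> k0" for n
    using that by (metis le_add_diff_inverse2)
  thus ?thesis
    by (auto simp: eventually_sequentially)
qed

theorem corollary1p1:
  fixes P :: "real^'x^'x::finite"
    and a p :: "'x \<Rightarrow> real"
    and M :: "'x \<Rightarrow> 'w measure"
    and X :: "nat \<Rightarrow> 'w \<Rightarrow> 'x"
    and \<xi> :: "'x \<Rightarrow> nat \<Rightarrow> nat \<Rightarrow> 'w \<Rightarrow> nat"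
    and d :: real
  assumes "lf_branching_in_markov_env P a p M X \<xi>"
    and "primitive_env P"
    and "non_lattice_env P a p"
    and "supercritical_env a p"
    and "(walk_growth a p M X has_real_derivative d) (at (-1))"
    and "d > 0"
  shows "\<forall>c::nat. c \<ge> 1 \<longrightarrow> (\<forall>z\<in>{1..c}. \<forall>i j.
    (\<lambda>n. \<P>(\<omega> in M i. branching X \<xi> n \<omega> = z \<bar>
             1 \<le> branching X \<xi> n \<omega> \<and> branching X \<xi> n \<omega> \<le> c \<and> X n \<omega> = j))
      \<longlonglongrightarrow> 1 / real c)"
proof (intro allI impI ballI)
  fix c z :: nat and i j :: 'x
  assume c: "c \<ge> 1" and z: "z \<in> {1..c}"
  note env = assms(1)[unfolded lf_branching_in_markov_env_def]
  interpret prob_space "M i" using env by blast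
  interpret lf_branching_process "M i" a p \<xi> P i X
  proof unfold_locales
    show "indep_vars (\<lambda>_. count_space UNIV) (\<lambda>(i, n, l). \<xi> i n l) offspring_index"
      and "\<And>n l y k. 1 \<le> n \<Longrightarrow> 1 \<le> l \<Longrightarrow> \<P>(\<omega> in M i. \<xi> y n l \<omega> = k) = lf_mass (a y) (p y) k"
      using env by (auto simp: lf_offspring_family_def)
  qed (use env in auto)
  \<comment> \<open>The largest inverse mean and the smallest increment, extremal over the finite
    state space.\<close>
  define \<theta> where "\<theta> = Max (range (\<lambda>y. (1 - p y) / (1 - a y)))"
  define \<eta> where "\<eta> = Min (range (\<lambda>y. p y / (1 - a y)))"
  have \<theta>: "(1 - p y) / (1 - a y) \<le> \<theta>" for y
    by (simp add: \<theta>_def)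
  \<comment> \<open>The maximum is attained, so the statewise strict inequality
    \<open>a y < p y\<close> yields \<open>\<theta> < 1\<close>.\<close>
  have "\<theta> \<in> range (\<lambda>y. (1 - p y) / (1 - a y))"
    unfolding \<theta>_def by (intro Max_in) auto
  hence \<theta>_bounds: "0 \<le> \<theta>" "\<theta> < 1"
    using assms(4) a_less_1 p_less_1 by (auto simp: supercritical_env_def less_imp_le)
  have \<eta>: "\<eta> \<le> p y / (1 - a y)" for y
    by (simp add: \<eta>_def)
  have "\<eta> \<in> range (\<lambda>y. p y / (1 - a y))"
    unfolding \<eta>_def by (intro Min_in) auto
  hence \<eta>_pos: "\<eta> > 0"
    using a_less_1 p_pos by auto
  define w where "w y n = \<P>(\<omega> in M i. branching X \<xi> n \<omega> = y \<and> X n \<omega> = j)" for y n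
  have w_pos: "\<forall>\<^sub>F n in sequentially. w 1 n > 0"
    using primitive_env_eventually_pos[OF assms(2) stochastic, of j]
  proof eventually_elim
    case (elim n)
    thus ?case
      unfolding w_def by (intro prob_branching_chain_pos) (simp add: prob_chain_eq)
  qed
  have ratio: "(\<lambda>n. w y n / w 1 n) \<longlonglongrightarrow> 1" if y: "y \<ge> 1" for y
  proof (rule tendsto_sandwich)
    have "(\<lambda>n. (1 / (1 + \<theta> ^ n / \<eta>)) ^ (y - 1)) \<longlonglongrightarrow> (1 / (1 + 0 / \<eta>)) ^ (y - 1)"
      using \<theta>_bounds \<eta>_pos by (intro tendsto_intros LIMSEQ_realpow_zero) auto
    thus "(\<lambda>n. (1 / (1 + \<theta> ^ n / \<eta>)) ^ (y - 1)) \<longlonglongrightarrow> 1"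
      by simp
    show "\<forall>\<^sub>F n in sequentially. (1 / (1 + \<theta> ^ n / \<eta>)) ^ (y - 1) \<le> w y n / w 1 n"
      using w_pos eventually_ge_at_top[of 1]
    proof eventually_elim
      case (elim n)
      thus ?case
        using prob_branching_chain_ge[OF \<theta> \<eta> \<eta>_pos, of n y j] y by (simp add: w_def pos_le_divide_eq)
    qed
    show "\<forall>\<^sub>F n in sequentially. w y n / w 1 n \<le> 1"
      using w_pos
    proof eventually_elim
      case (elim n)
      thus ?case
        using prob_branching_chain_le[OF y, of n j] by (simp add: w_def)
    qed
  qed simp
  \<comment> \<open>Numerator and denominator of the conditional probability are divided by
    \<open>w 1 n\<close>; each of the \<open>c\<close> summands below then tends to 1. The
    cancellation is legitimate once \<open>w 1 n\<close> is positive, hence only eventually.\<close>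
  have "(\<lambda>n. (w z n / w 1 n) / (\<Sum>y\<in>{1..c}. w y n / w 1 n)) \<longlonglongrightarrow> 1 / (\<Sum>y\<in>{1..c}. 1)"
    using c z by (intro tendsto_divide tendsto_sum ratio) auto
  moreover have "\<forall>\<^sub>F n in sequentially. (w z n / w 1 n) / (\<Sum>y\<in>{1..c}. w y n / w 1 n) =
      \<P>(\<omega> in M i. branching X \<xi> n \<omega> = z \<bar>
             1 \<le> branching X \<xi> n \<omega> \<and> branching X \<xi> n \<omega> \<le> c \<and> X n \<omega> = j)"
    using w_pos
  proof eventually_elim
    case (elim n)
    thus ?case
      unfolding cond_prob_branching_eq[OF z] by (simp add: w_def flip: sum_divide_distrib)
  qed
  ultimately show "(\<lambda>n. \<P>(\<omega> in M i. branching X \<xi> n \<omega> = z \<bar>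
             1 \<le> branching X \<xi> n \<omega> \<and> branching X \<xi> n \<omega> \<le> c \<and> X n \<omega> = j))
      \<longlonglongrightarrow> 1 / real c"
    using Lim_transform_eventually by fastforce
qed

end
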